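(* For almost every $f\in\Omega$ (with respect to the probability $P$ on $\Omega$), $$\limsup_{m\to\infty}\frac{\|\widehat{\pi_m(f)}\|_\infty}{2^{m/2}\sqrt m}\le\sqrt{2\log 2}.$$
   Context: $V_m=\mathbb{F}_2^m$, embedded in $V_{m+1}$ by $(x_1,\dots,x_m)\mapsto(x_1,\dots,x_m,0)$; $V_\infty=\bigcup_m V_m=\mathbb{F}_2^{(\mathbb{N})}$ is the space of sequences in $\mathbb{F}_2$ with finitely many nonzero terms. $\Omega=\{\pm1\}^{V_\infty}$ is the set of all functions $V_\infty\to\{\pm1\}$, $\Omega_m$ the set of functions $V_m\to\{\pm1\}$, and $\pi_m:\Omega\to\Omega_m$ is restriction to $V_m$. $\Omega$ carries the $\sigma$-algebra generated by the sets $\pi_m^{-1}(A)$, $A\subseteq\Omega_m$, $m\ge1$, and the probability $P$ determined by $P(\pi_m^{-1}(\{g\}))=2^{-2^m}$ for every $g\in\Omega_m$ (i.e. the values $f(x)$, $x\in V_\infty$, are independent and uniform on $\{\pm1\}$). For $g:V_m\to\{\pm1\}$, $\widehat g(\chi)=\sum_{x\in V_m}g(x)\chi(x)$ for each character (homomorphism) $\chi:V_m\to\{\pm1\}$, and $\|\widehat g\|_\infty=\max_\chi|\widehat g(\chi)|$. $\log$ is the natural logarithm. *)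

theory Defs
  imports "HOL-Probability.Probability" "HOL-Library.Poly_Mapping" "HOL-Library.Z2"
begin

text \<open>
  The space of finitely supported sequences over the two-element field is the type
  \<^typ>\<open>nat \<Rightarrow>\<^sub>0 bit\<close>. Coordinates are numbered from 0, and the space of dimension \<open>m\<close> is
  identified with its image under extension by zero, so that the embeddings are inclusions.
\<close>

definition V :: "nat \<Rightarrow> (nat \<Rightarrow>\<^sub>0 bit) set" where
  "V m = {x. \<forall>i\<ge>m. Poly_Mapping.lookup x i = 0}"

definition \<Omega> :: "((nat \<Rightarrow>\<^sub>0 bit) \<Rightarrow> real) set" where
  "\<Omega> = UNIV \<rightarrow> {-1, 1}"

definition \<Omega>_fin :: "nat \<Rightarrow> ((nat \<Rightarrow>\<^sub>0 bit) \<Rightarrow> real) set" where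
  "\<Omega>_fin m = V m \<rightarrow>\<^sub>E {-1, 1}"

definition restr :: "nat \<Rightarrow> ((nat \<Rightarrow>\<^sub>0 bit) \<Rightarrow> real) \<Rightarrow> ((nat \<Rightarrow>\<^sub>0 bit) \<Rightarrow> real)" where
  "restr m f = restrict f (V m)"

text \<open>
  The lemmas \<open>space_P\<close>, \<open>sets_P\<close>, \<open>emeasure_P_cylinder\<close> and \<open>P_unique\<close> below show that this
  product measure lives on the \<open>\<sigma>\<close>-algebra generated by the cylinder sets and is the only
  measure there with the prescribed cylinder probabilities.
\<close>

definition P :: "((nat \<Rightarrow>\<^sub>0 bit) \<Rightarrow> real) measure" where
  "P = PiM UNIV (\<lambda>_. uniform_count_measure {-1, 1})"

definition characters :: "nat \<Rightarrow> ((nat \<Rightarrow>\<^sub>0 bit) \<Rightarrow> real) set" where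
  "characters m = {\<psi> \<in> \<Omega>_fin m. \<forall>x\<in>V m. \<forall>y\<in>V m. \<psi> (x + y) = \<psi> x * \<psi> y}"

definition fourier :: "nat \<Rightarrow> ((nat \<Rightarrow>\<^sub>0 bit) \<Rightarrow> real) \<Rightarrow> ((nat \<Rightarrow>\<^sub>0 bit) \<Rightarrow> real) \<Rightarrow> real" where
  "fourier m g \<psi> = (\<Sum>x\<in>V m. g x * \<psi> x)"

definition fourier_sup_norm :: "nat \<Rightarrow> ((nat \<Rightarrow>\<^sub>0 bit) \<Rightarrow> real) \<Rightarrow> real" where
  "fourier_sup_norm m g = Max ((\<lambda>\<psi>. \<bar>fourier m g \<psi>\<bar>) ` characters m)"

lemma V_mono: "m \<le> n \<Longrightarrow> V m \<subseteq> V n"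
  by (auto simp: V_def)

lemma ex_V: "\<exists>m\<ge>1. x \<in> V m"
proof -
  have "finite {i. Poly_Mapping.lookup x i \<noteq> 0}" by (rule finite_lookup)
  then obtain n where n: "\<forall>i\<in>{i. Poly_Mapping.lookup x i \<noteq> 0}. i < n"
    using finite_nat_set_iff_bounded by blast
  have "x \<in> V (Suc n)"
    unfolding V_def mem_Collect_eq
  proof (intro allI impI)
    fix i assume "Suc n \<le> i"
    then have "\<not> i < n" by simp
    then show "Poly_Mapping.lookup x i = 0" using n by blast
  qed
  then show ?thesis by (intro exI[of _ "Suc n"]) simp
qed

lemma UN_V: "(\<Union>m. V m) = UNIV"
  using ex_V by blast

lemma bij_betw_V:
  "bij_betw (\<lambda>x. restrict (Poly_Mapping.lookup x) {..<m}) (V m) ({..<m} \<rightarrow>\<^sub>E (UNIV :: bit set))"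
proof (rule bij_betwI')
  fix x y assume x: "x \<in> V m" and y: "y \<in> V m"
  show "(restrict (Poly_Mapping.lookup x) {..<m} = restrict (Poly_Mapping.lookup y) {..<m}) = (x = y)"
  proof
    assume eq: "restrict (Poly_Mapping.lookup x) {..<m} = restrict (Poly_Mapping.lookup y) {..<m}"
    show "x = y"
    proof (rule poly_mapping_eqI)
      fix i
      show "Poly_Mapping.lookup x i = Poly_Mapping.lookup y i"
      proof (cases "i < m")
        case True
        then show ?thesis using fun_cong[OF eq, of i] by simp
      next
        case False
        then show ?thesis using x y by (simp add: V_def)
      qed
    qed
  qed simp
next
  fix x assume "x \<in> V m"
  show "restrict (Poly_Mapping.lookup x) {..<m} \<in> {..<m} \<rightarrow>\<^sub>E (UNIV :: bit set)" by auto
next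
  fix h assume h: "h \<in> {..<m} \<rightarrow>\<^sub>E (UNIV :: bit set)"
  define k where "k i = (if i < m then h i else 0)" for i
  have "{i. k i \<noteq> 0} \<subseteq> {..<m}"
    by (auto simp: k_def split: if_splits)
  then have "finite {i. k i \<noteq> 0}"
    by (rule finite_subset) simp
  then have l: "Poly_Mapping.lookup (Abs_poly_mapping k) = k" by simp
  have "Abs_poly_mapping k \<in> V m" by (simp add: V_def l k_def)
  moreover have "h = restrict (Poly_Mapping.lookup (Abs_poly_mapping k)) {..<m}"
    using h by (auto simp: l k_def fun_eq_iff PiE_def extensional_def)
  ultimately show "\<exists>x\<in>V m. h = restrict (Poly_Mapping.lookup x) {..<m}" by blast
qed

lemma UNIV_bit: "(UNIV :: bit set) = {0, 1}"
  by auto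

lemma finite_V: "finite (V m)"
  using bij_betw_finite[OF bij_betw_V[of m]] by (simp add: UNIV_bit finite_PiE)

lemma card_V: "card (V m) = 2 ^ m"
  using bij_betw_same_card[OF bij_betw_V[of m]] by (simp add: card_PiE UNIV_bit numeral_2_eq_2)

lemma finite_\<Omega>_fin: "finite (\<Omega>_fin m)"
  unfolding \<Omega>_fin_def using finite_V by (intro finite_PiE) auto

lemma finite_characters: "finite (characters m)"
  by (rule finite_subset[OF _ finite_\<Omega>_fin]) (auto simp: characters_def)

lemma characters_nonempty: "characters m \<noteq> {}"
proof -
  have "restrict (\<lambda>_. 1) (V m) \<in> characters m"
    by (auto simp: characters_def \<Omega>_fin_def V_def lookup_add)
  then show ?thesis by blast
qed

interpretation coin: product_prob_space "\<lambda>_ :: nat \<Rightarrow>\<^sub>0 bit. uniform_count_measure {-1, 1 :: real}" UNIV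
  by (intro product_prob_spaceI prob_space_uniform_count_measure) auto

lemma prob_space_P: "prob_space P"
  unfolding P_def by (rule coin.prob_space_axioms)

lemma space_P: "space P = \<Omega>"
  by (simp add: P_def \<Omega>_def space_PiM space_uniform_count_measure PiE_UNIV_domain)

lemma sets_fin:
  assumes "A \<subseteq> \<Omega>_fin m"
  shows "A \<in> sets (PiM (V m) (\<lambda>_. uniform_count_measure {-1, 1 :: real}))"
proof -
  have "{g} \<in> sets (PiM (V m) (\<lambda>_. uniform_count_measure {-1, 1 :: real}))" if "g \<in> A" for g
  proof -
    have g: "g \<in> V m \<rightarrow>\<^sub>E {-1, 1}" using that assms by (auto simp: \<Omega>_fin_def)
    have "{g} = (\<Pi>\<^sub>E x\<in>V m. {g x})" using PiE_singleton[of g "V m"] g by (auto simp: PiE_def)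
    moreover have "(\<Pi>\<^sub>E x\<in>V m. {g x}) \<in> sets (PiM (V m) (\<lambda>_. uniform_count_measure {-1, 1 :: real}))"
      using g by (intro sets_PiM_I_finite finite_V) (auto simp: sets_uniform_count_measure PiE_iff)
    ultimately show ?thesis by simp
  qed
  moreover have "finite A" using assms finite_\<Omega>_fin finite_subset by blast
  ultimately have "(\<Union>g\<in>A. {g}) \<in> sets (PiM (V m) (\<lambda>_. uniform_count_measure {-1, 1 :: real}))"
    by (intro sets.finite_UN) auto
  then show ?thesis by simp
qed

lemma restr_measurable: "restr m \<in> measurable P (PiM (V m) (\<lambda>_. uniform_count_measure {-1, 1 :: real}))"
  unfolding P_def restr_def[abs_def] by (rule measurable_restrict_subset) simp

lemma sets_P: "sets P = sigma_sets \<Omega> {restr m -` A \<inter> \<Omega> | m A. m \<ge> 1 \<and> A \<subseteq> \<Omega>_fin m}" (is "_ = sigma_sets _ ?G")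
proof
  show "sets P \<subseteq> sigma_sets \<Omega> ?G"
    unfolding P_def sets_PiM_single
  proof (rule sigma_sets_subseteq[THEN subset_trans, rotated])
    show "sigma_sets (\<Pi>\<^sub>E i\<in>UNIV. space (uniform_count_measure {-1, 1 :: real})) ?G \<subseteq> sigma_sets \<Omega> ?G"
      by (simp add: \<Omega>_def space_uniform_count_measure PiE_UNIV_domain)
    show "{{f \<in> \<Pi>\<^sub>E i\<in>UNIV. space (uniform_count_measure {-1, 1 :: real}). f i \<in> A} | i A.
        i \<in> (UNIV :: (nat \<Rightarrow>\<^sub>0 bit) set) \<and> A \<in> sets (uniform_count_measure {-1, 1 :: real})} \<subseteq> ?G"
    proof clarify
      fix x :: "nat \<Rightarrow>\<^sub>0 bit" and A
      assume A: "A \<in> sets (uniform_count_measure {-1, 1 :: real})"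
      obtain m where m: "m \<ge> 1" "x \<in> V m" using ex_V by blast
      have "{f \<in> \<Pi>\<^sub>E i\<in>UNIV. space (uniform_count_measure {-1, 1 :: real}). f x \<in> A}
          = restr m -` {g \<in> \<Omega>_fin m. g x \<in> A} \<inter> \<Omega>"
        using m by (auto simp: \<Omega>_def \<Omega>_fin_def restr_def space_uniform_count_measure PiE_UNIV_domain Pi_iff)
      then show "\<exists>m B. {f \<in> \<Pi>\<^sub>E i\<in>UNIV. space (uniform_count_measure {-1, 1 :: real}). f x \<in> A}
          = restr m -` B \<inter> \<Omega> \<and> 1 \<le> m \<and> B \<subseteq> \<Omega>_fin m"
        using m by (intro exI[of _ m] exI[of _ "{g \<in> \<Omega>_fin m. g x \<in> A}"]) simp
    qed
  qed
  show "sigma_sets \<Omega> ?G \<subseteq> sets P"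
    unfolding space_P[symmetric]
    using measurable_sets[OF restr_measurable sets_fin]
    by (intro sets.sigma_sets_subset) auto
qed

lemma emeasure_P_cylinder:
  assumes "g \<in> \<Omega>_fin m"
  shows "emeasure P (restr m -` {g} \<inter> \<Omega>) = ennreal (1 / 2 ^ (2 ^ m))"
proof -
  have g: "g \<in> V m \<rightarrow>\<^sub>E {-1, 1}" using assms by (simp add: \<Omega>_fin_def)
  have eq: "restr m -` {g} \<inter> \<Omega> =
      prod_emb UNIV (\<lambda>_. uniform_count_measure {-1, 1 :: real}) (V m) (\<Pi>\<^sub>E x\<in>V m. {g x})"
    using PiE_singleton[of g "V m"] g
    by (auto simp: prod_emb_def restr_def \<Omega>_def space_uniform_count_measure PiE_UNIV_domain PiE_def)
  have "emeasure P (restr m -` {g} \<inter> \<Omega>) = (\<Prod>x\<in>V m. emeasure (uniform_count_measure {-1, 1 :: real}) {g x})"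
    unfolding eq P_def using g
    by (intro coin.emeasure_PiM_emb finite_V) (auto simp: sets_uniform_count_measure PiE_iff)
  also have "\<dots> = (\<Prod>x\<in>V m. ennreal (1 / 2))"
    using g by (intro prod.cong) (auto simp: emeasure_uniform_count_measure PiE_iff divide_ennreal_def)
  also have "\<dots> = ennreal (1 / 2 ^ (2 ^ m))"
    by (simp only: prod_constant card_V ennreal_power zero_le_divide_1_iff zero_le_numeral power_one_over)
  finally show ?thesis .
qed

lemma P_unique:
  assumes sets_Q: "sets Q = sets P"
    and Q: "\<And>m g. m \<ge> 1 \<Longrightarrow> g \<in> \<Omega>_fin m \<Longrightarrow>
      emeasure Q (restr m -` {g} \<inter> \<Omega>) = ennreal (1 / 2 ^ (2 ^ m))"
  shows "Q = P"
proof -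
  let ?G = "{restr m -` A \<inter> \<Omega> | m A. m \<ge> 1 \<and> A \<subseteq> \<Omega>_fin m}"
  have cyl: "restr m -` A \<inter> \<Omega> \<in> sets P" if "A \<subseteq> \<Omega>_fin m" for m A
    using measurable_sets[OF restr_measurable sets_fin[OF that]] by (simp add: space_P)
  have eq: "emeasure P (restr m -` A \<inter> \<Omega>) = emeasure Q (restr m -` A \<inter> \<Omega>)"
    if "m \<ge> 1" "A \<subseteq> \<Omega>_fin m" for m A
  proof -
    have fin: "finite A" using that finite_\<Omega>_fin finite_subset by blast
    have UN: "restr m -` A \<inter> \<Omega> = (\<Union>g\<in>A. restr m -` {g} \<inter> \<Omega>)" by auto
    have im: "(\<lambda>g. restr m -` {g} \<inter> \<Omega>) ` A \<subseteq> sets P" using cyl that by blast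
    have dj: "disjoint_family_on (\<lambda>g. restr m -` {g} \<inter> \<Omega>) A" by (auto simp: disjoint_family_on_def)
    have "emeasure P (restr m -` A \<inter> \<Omega>) = (\<Sum>g\<in>A. emeasure P (restr m -` {g} \<inter> \<Omega>))"
      unfolding UN by (rule sum_emeasure[symmetric, OF im dj fin])
    also have "\<dots> = (\<Sum>g\<in>A. emeasure Q (restr m -` {g} \<inter> \<Omega>))"
      using that by (intro sum.cong) (auto simp: Q emeasure_P_cylinder)
    also have "\<dots> = emeasure Q (restr m -` A \<inter> \<Omega>)"
      unfolding UN using im sets_Q by (intro sum_emeasure dj fin) auto
    finally show ?thesis .
  qed
  have lift: "\<exists>B\<subseteq>\<Omega>_fin n. restr m -` A \<inter> \<Omega> = restr n -` B \<inter> \<Omega>"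
    if "m \<le> n" for m n A
  proof (intro exI conjI)
    have rr: "restr m (restr n f) = restr m f" for f
      using V_mono[OF that] by (auto simp: restr_def fun_eq_iff)
    have rn: "restr n f \<in> \<Omega>_fin n" if "f \<in> \<Omega>" for f
      using that by (auto simp: restr_def \<Omega>_def \<Omega>_fin_def)
    show "restr m -` A \<inter> \<Omega> = restr n -` {h \<in> \<Omega>_fin n. restr m h \<in> A} \<inter> \<Omega>"
      using rr rn by auto
  qed auto
  have int: "Int_stable ?G"
  proof (rule Int_stableI)
    fix a b assume "a \<in> ?G" "b \<in> ?G"
    then obtain m A n B where ab: "a = restr m -` A \<inter> \<Omega>" "m \<ge> 1" "b = restr n -` B \<inter> \<Omega>" by auto
    obtain A' where A': "A' \<subseteq> \<Omega>_fin (max m n)" "a = restr (max m n) -` A' \<inter> \<Omega>"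
      using lift[of m "max m n" A] ab by auto
    obtain B' where B': "B' \<subseteq> \<Omega>_fin (max m n)" "b = restr (max m n) -` B' \<inter> \<Omega>"
      using lift[of n "max m n" B] ab by auto
    have "a \<inter> b = restr (max m n) -` (A' \<inter> B') \<inter> \<Omega>" using A' B' by auto
    moreover have "max m n \<ge> 1" "A' \<inter> B' \<subseteq> \<Omega>_fin (max m n)" using ab A' by auto
    ultimately show "a \<inter> b \<in> ?G" by blast
  qed
  have full: "\<Omega> = restr 1 -` \<Omega>_fin 1 \<inter> \<Omega>"
    unfolding restr_def \<Omega>_def \<Omega>_fin_def by (fastforce simp: Pi_iff)
  have "P = Q"
  proof (rule measure_eqI_generator_eq[where E = ?G and \<Omega> = \<Omega> and A = "\<lambda>_. \<Omega>"])
    show "Int_stable ?G" by (rule int)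
    show "?G \<subseteq> Pow \<Omega>" by auto
    show "emeasure P X = emeasure Q X" if "X \<in> ?G" for X using that eq by auto
    show "sets P = sigma_sets \<Omega> ?G" by (rule sets_P)
    show "sets Q = sigma_sets \<Omega> ?G" using sets_P sets_Q by simp
    show "range (\<lambda>_ :: nat. \<Omega>) \<subseteq> ?G" using full by blast
    show "(\<Union>i::nat. \<Omega>) = \<Omega>" by simp
    show "emeasure P \<Omega> \<noteq> \<infinity>" for i :: nat
      using prob_space.emeasure_space_1[OF prob_space_P] by (simp add: space_P)
  qed
  then show ?thesis by simp
qed

end

(* A character of V m is determined by its values on the m unit vectors, so there are at most 2^m
   of them. For a fixed character, the Fourier coefficient of f is a sum of 2^m independent
   uniform signs, and Hoeffding's inequality bounds the probability that it reaches
   c * 2^(m/2) * sqrt m by 2 * exp (- c^2 * m / 2). A union bound leaves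
   2 * exp (ln 2 - c^2 / 2) ^ m, which is summable as soon as c > sqrt (2 * ln 2), so the
   Borel-Cantelli lemma applies; finally let c tend to sqrt (2 * ln 2) along a sequence. *)
theory Submission
  imports Defs
begin

section \<open>Counting characters\<close>

lemma bit_poly_mapping_add_self: "x + x = (0 :: 'a \<Rightarrow>\<^sub>0 bit)"
  by (rule poly_mapping_eqI) (simp add: lookup_add)

lemma single_in_V: "i < m \<Longrightarrow> Poly_Mapping.single i 1 \<in> V m"
  by (auto simp: V_def lookup_single when_def)

lemma V_0: "V 0 = {0}"
  by (auto simp: V_def intro: poly_mapping_eqI)

text \<open>Over the two-element field, adding the unit vector \<open>single k 1\<close> clears a
  nonzero coordinate \<open>k\<close>. This drives the induction along the chain \<open>V 0\<close>,
  \<open>V 1\<close>, ... in \<open>characters_eqI\<close>.\<close>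

lemma V_Suc_cases:
  assumes "x \<in> V (Suc k)"
  shows "x \<in> V k \<or> x + Poly_Mapping.single k 1 \<in> V k"
proof (cases "Poly_Mapping.lookup x k = 0")
  case True
  then show ?thesis using assms by (auto simp: V_def not_less_eq_eq le_Suc_eq dest: le_neq_implies_less)
next
  case False
  then have k: "Poly_Mapping.lookup x k = 1" by (cases "Poly_Mapping.lookup x k") auto
  have "Poly_Mapping.lookup (x + Poly_Mapping.single k 1) i = 0" if "i \<ge> k" for i
    using that assms k by (cases "i = k") (auto simp: V_def lookup_add lookup_single)
  then show ?thesis by (simp add: V_def)
qed

lemma characterD:
  assumes "\<psi> \<in> characters m"
  shows "x \<in> V m \<Longrightarrow> y \<in> V m \<Longrightarrow> \<psi> (x + y) = \<psi> x * \<psi> y"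
    and "x \<in> V m \<Longrightarrow> \<psi> x \<in> {-1, 1}"
    and "\<psi> \<in> extensional (V m)"
  using assms by (auto simp: characters_def \<Omega>_fin_def PiE_def)

lemma character_zero:
  assumes "\<psi> \<in> characters m"
  shows "\<psi> 0 = 1"
proof -
  have "0 \<in> V m" by (simp add: V_def)
  then show ?thesis
    using characterD(1)[OF assms, of 0 0] characterD(2)[OF assms, of 0] by auto
qed

lemma characters_eqI:
  assumes \<psi>: "\<psi> \<in> characters m" and \<phi>: "\<phi> \<in> characters m"
    and eq: "\<And>i. i < m \<Longrightarrow> \<psi> (Poly_Mapping.single i 1) = \<phi> (Poly_Mapping.single i 1)"
  shows "\<psi> = \<phi>"
proof -
  \<comment> \<open>Both characters stay fixed on \<open>V m\<close> while the induction climbs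
    through the subspaces \<open>V k\<close>; the bound \<open>k \<le> m\<close> keeps every vector
    inside their domain.\<close>
  have agree: "\<psi> x = \<phi> x" if "k \<le> m" "x \<in> V k" for k x
    using that
  proof (induction k arbitrary: x)
    case 0
    then show ?case using character_zero[OF \<psi>] character_zero[OF \<phi>] by (simp add: V_0)
  next
    case (Suc k)
    let ?e = "Poly_Mapping.single k (1 :: bit)"
    show ?case
    proof (cases "x \<in> V k")
      case True
      then show ?thesis using Suc by simp
    next
      case False
      then have y: "x + ?e \<in> V k" using V_Suc_cases Suc.prems by blast
      then have yV: "x + ?e \<in> V m" using V_mono[of k m] Suc.prems by auto
      have eV: "?e \<in> V m" using Suc.prems by (intro single_in_V) simp
      \<comment> \<open>In characteristic 2 this recovers \<open>x\<close> as a sum of two vectors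
        of \<open>V m\<close>, so multiplicativity splits off the value at the unit vector.\<close>
      have x: "(x + ?e) + ?e = x" by (simp only: add.assoc bit_poly_mapping_add_self add_0_right)
      have "\<psi> x = \<psi> (x + ?e) * \<psi> ?e" "\<phi> x = \<phi> (x + ?e) * \<phi> ?e"
        using characterD(1)[OF \<psi> yV eV] characterD(1)[OF \<phi> yV eV] by (simp_all only: x)
      then show ?thesis using Suc.IH[OF _ y] Suc.prems eq[of k] by simp
    qed
  qed
  show ?thesis
    using characterD(3)[OF \<psi>] characterD(3)[OF \<phi>] agree[OF order_refl] by (rule extensionalityI)
qed

text \<open>Evaluation at the \<open>m\<close> unit vectors is injective by
  \<open>characters_eqI\<close>, and it lands in the set of sign patterns of length
  \<open>m\<close>.\<close>

lemma card_characters_le: "card (characters m) \<le> 2 ^ m"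
proof -
  let ?r = "\<lambda>\<psi> :: (nat \<Rightarrow>\<^sub>0 bit) \<Rightarrow> real. \<lambda>i\<in>{..<m}. \<psi> (Poly_Mapping.single i 1)"
  have "card (characters m) \<le> card ({..<m} \<rightarrow>\<^sub>E {-1, 1 :: real})"
  proof (rule card_inj_on_le)
    show "inj_on ?r (characters m)"
    proof (rule inj_onI, rule characters_eqI)
      fix \<psi> \<phi> i assume "?r \<psi> = ?r \<phi>" "i < m"
      then show "\<psi> (Poly_Mapping.single i 1) = \<phi> (Poly_Mapping.single i 1)"
        by (metis lessThan_iff restrict_apply')
    qed
    show "?r ` characters m \<subseteq> {..<m} \<rightarrow>\<^sub>E {-1, 1}"
      by (intro image_subsetI PiE_I) (use characterD(2) single_in_V in auto)
  qed (intro finite_PiE; simp)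
  then show ?thesis by (simp add: card_PiE numeral_2_eq_2)
qed

section \<open>Independent signs\<close>

text \<open>Independence amounts to the joint law being the product of the marginals. Here the joint
  map is the identity on the product space and the marginals are the factors \<open>M i\<close>. The
  criterion is applied to nonempty \<open>I\<close>, hence the case split.\<close>

lemma (in product_prob_space) indep_vars_PiM_coordinates:
  "prob_space.indep_vars (PiM I M) M (\<lambda>i \<omega>. \<omega> i) I"
proof (cases "I = {}")
  case True
  then show ?thesis unfolding P.indep_vars_def P.indep_sets_def by simp
next
  case False
  have "distr (PiM I M) (PiM I M) (\<lambda>\<omega>. \<lambda>i\<in>I. \<omega> i) = distr (PiM I M) (PiM I M) (\<lambda>\<omega>. \<omega>)"
    by (intro distr_cong) (auto simp: space_PiM PiE_def extensional_restrict)
  also have "\<dots> = (\<Pi>\<^sub>M i\<in>I. distr (PiM I M) (M i) (\<lambda>\<omega>. \<omega> i))"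
    by (simp add: distr_id2 distr_PiM_component M.prob_space_axioms cong: PiM_cong)
  finally show ?thesis
    using False by (subst P.indep_vars_iff_distr_eq_PiM') auto
qed

lemma measurable_coordinate_P: "(\<lambda>f. f x) \<in> borel_measurable P"
proof -
  have "(\<lambda>f. f x) \<in> measurable P (uniform_count_measure {-1, 1 :: real})"
    unfolding P_def by (rule measurable_component_singleton) simp
  \<comment> \<open>Every subset of {-1, 1} is measurable for the counting measure, so any real
    function on it is Borel.\<close>
  moreover have "(\<lambda>z. z) \<in> borel_measurable (uniform_count_measure {-1, 1 :: real})"
    by (simp add: measurable_def space_uniform_count_measure sets_uniform_count_measure)
  ultimately show ?thesis
    by (rule measurable_compose)
qed

lemma expectation_coordinate_P: "(\<integral>f. f x \<partial>P) = 0"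
proof -
  let ?U = "uniform_count_measure {-1, 1 :: real}"
  have "0 = (\<integral>z. z \<partial>?U)"
    by (simp add: integral_uniform_count_measure)
  also have "?U = distr P ?U (\<lambda>f. f x)"
    unfolding P_def by (rule distr_PiM_component[symmetric]) (auto intro: prob_space_uniform_count_measure)
  also have "(\<integral>z. z \<partial>distr P ?U (\<lambda>f. f x)) = (\<integral>f. f x \<partial>P)"
  proof (rule integral_distr)
    show "(\<lambda>f. f x) \<in> measurable P ?U"
      unfolding P_def by (rule measurable_component_singleton) simp
    show "(\<lambda>z. z) \<in> borel_measurable ?U"
      by (simp add: measurable_def space_uniform_count_measure sets_uniform_count_measure)
  qed
  finally show ?thesis by simp
qed

lemma measurable_fourier: "(\<lambda>f. fourier m f \<psi>) \<in> borel_measurable P"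
  unfolding fourier_def
  by (intro borel_measurable_sum borel_measurable_times measurable_coordinate_P) auto

text \<open>Hoeffding's inequality for the centred independent variables
  \<open>f x * \<psi> x\<close>. Each takes values in an interval of length 2, so the squared
  lengths sum to \<open>4 * 2 ^ m\<close> and the exponent
  \<open>-2 * \<epsilon>\<^sup>2 / (4 * 2 ^ m)\<close> reduces to the stated one.\<close>

lemma prob_fourier_ge:
  assumes \<psi>: "\<psi> \<in> \<Omega>_fin m" and \<epsilon>: "\<epsilon> \<ge> 0"
  shows "measure P {f \<in> space P. \<epsilon> \<le> \<bar>fourier m f \<psi>\<bar>} \<le> 2 * exp (- \<epsilon>\<^sup>2 / (2 * 2 ^ m))"
proof -
  have sign: "\<psi> x \<in> {-1, 1}" if "x \<in> V m" for x
    using \<psi> that by (auto simp: \<Omega>_fin_def)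
  have indep: "prob_space.indep_vars P (\<lambda>_. borel) (\<lambda>x f. f x * \<psi> x) (V m)"
  proof (rule prob_space.indep_vars_compose2[OF prob_space_P, where Y = "\<lambda>x z. z * \<psi> x"])
    show "prob_space.indep_vars P (\<lambda>_. uniform_count_measure {-1, 1}) (\<lambda>x f. f x) (V m)"
      using coin.indep_vars_PiM_coordinates unfolding P_def[symmetric]
      by (rule prob_space.indep_vars_subset[OF prob_space_P]) simp
    show "(\<lambda>z. z * \<psi> x) \<in> borel_measurable (uniform_count_measure {-1, 1})" for x
      by (simp add: measurable_def space_uniform_count_measure sets_uniform_count_measure)
  qed
  have range: "AE f in P. f x * \<psi> x \<in> {-1..1}" if "x \<in> V m" for x
  proof (rule AE_I2)
    fix f assume "f \<in> space P"
    then have "f x \<in> {-1, 1}" by (auto simp: space_P \<Omega>_def)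
    then show "f x * \<psi> x \<in> {-1..1}" using sign[OF that] by auto
  qed
  interpret prob_space P by (rule prob_space_P)
  interpret Hoeffding_ineq P "V m" "\<lambda>x f. f x * \<psi> x" "\<lambda>_. -1" "\<lambda>_. 1"
    "\<Sum>x\<in>V m. expectation (\<lambda>f. f x * \<psi> x)"
    by unfold_locales (use finite_V indep range in auto)
  show ?thesis
    using Hoeffding_ineq_abs_ge[OF \<epsilon>]
    by (simp add: expectation_coordinate_P card_V fourier_def field_simps)
qed

section \<open>The union bound and the limit\<close>

lemma fourier_restr: "fourier m (restr m f) \<psi> = fourier m f \<psi>"
  by (simp add: fourier_def restr_def)

lemma fourier_sup_norm_ge_iff:
  "\<epsilon> \<le> fourier_sup_norm m g \<longleftrightarrow> (\<exists>\<psi>\<in>characters m. \<epsilon> \<le> \<bar>fourier m g \<psi>\<bar>)"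
  unfolding fourier_sup_norm_def
  using finite_characters characters_nonempty by (subst Max_ge_iff) auto

text \<open>Writing the event as a finite union over characters yields both its measurability and
  the union bound.\<close>

lemma fourier_sup_norm_event:
  "{f \<in> space P. \<epsilon> \<le> fourier_sup_norm m (restr m f)} =
    (\<Union>\<psi>\<in>characters m. {f \<in> space P. \<epsilon> \<le> \<bar>fourier m f \<psi>\<bar>})"
  by (auto simp: fourier_sup_norm_ge_iff fourier_restr)

lemma fourier_event_measurable: "{f \<in> space P. \<epsilon> \<le> \<bar>fourier m f \<psi>\<bar>} \<in> sets P"
  by (intro borel_measurable_le borel_measurable_const borel_measurable_abs measurable_fourier)

lemma prob_fourier_sup_norm_ge:
  assumes "\<epsilon> \<ge> 0"
  shows "measure P {f \<in> space P. \<epsilon> \<le> fourier_sup_norm m (restr m f)}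
    \<le> 2 ^ m * (2 * exp (- \<epsilon>\<^sup>2 / (2 * 2 ^ m)))"
proof -
  interpret prob_space P by (rule prob_space_P)
  have "measure P {f \<in> space P. \<epsilon> \<le> fourier_sup_norm m (restr m f)}
      \<le> (\<Sum>\<psi>\<in>characters m. measure P {f \<in> space P. \<epsilon> \<le> \<bar>fourier m f \<psi>\<bar>})"
    unfolding fourier_sup_norm_event using fourier_event_measurable
    by (intro finite_measure_subadditive_finite finite_characters) auto
  also have "\<dots> \<le> real (card (characters m)) * (2 * exp (- \<epsilon>\<^sup>2 / (2 * 2 ^ m)))"
    using assms by (intro sum_bounded_above prob_fourier_ge) (auto simp: characters_def)
  also have "\<dots> \<le> 2 ^ m * (2 * exp (- \<epsilon>\<^sup>2 / (2 * 2 ^ m)))"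
    using of_nat_mono[OF card_characters_le[of m], where 'a = real]
    by (intro mult_right_mono) simp_all
  finally show ?thesis .
qed

lemma AE_eventually_fourier_sup_norm_less:
  assumes c: "c > sqrt (2 * ln 2)"
  shows "AE f in P. \<forall>\<^sub>F m in sequentially.
    fourier_sup_norm m (restr m f) < c * (2 powr (real m / 2) * sqrt (real m))"
proof -
  interpret prob_space P by (rule prob_space_P)
  define \<epsilon> where "\<epsilon> m = c * (2 powr (real m / 2) * sqrt (real m))" for m
  define A where "A m = {f \<in> space P. \<epsilon> m \<le> fourier_sup_norm m (restr m f)}" for m
  \<comment> \<open>The ratio of the geometric series: passing from \<open>m\<close> to
    \<open>m + 1\<close> costs a factor 2 from the character count and gains
    \<open>exp (- c\<^sup>2 / 2)\<close> from Hoeffding.\<close>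
  define q where "q = exp (ln 2 - c\<^sup>2 / 2)"
  have "0 \<le> sqrt (2 * ln (2 :: real))"
    by (intro real_sqrt_ge_zero mult_nonneg_nonneg ln_ge_zero) simp_all
  then have c0: "c \<ge> 0"
    using c by (rule order.trans[OF _ less_imp_le])
  \<comment> \<open>This is where the strict inequality on \<open>c\<close> enters: it gives
    \<open>q < 1\<close>.\<close>
  have "2 * ln 2 < c\<^sup>2"
    using c c0 by (metis real_sqrt_less_iff real_sqrt_unique)
  then have "exp (ln 2 - c\<^sup>2 / 2) < 1"
    unfolding exp_less_one_iff by linarith
  then have q: "0 \<le> q" "q < 1"
    by (simp_all only: q_def exp_ge_zero)
  have bound: "measure P (A m) \<le> 2 * q ^ m" for m
  proof -
    have "(2 powr (real m / 2))\<^sup>2 = (2 :: real) ^ m"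
      by (simp add: power2_eq_square powr_add[symmetric] powr_realpow)
    then have sq: "(\<epsilon> m)\<^sup>2 = c\<^sup>2 * 2 ^ m * real m"
      by (simp add: \<epsilon>_def power_mult_distrib)
    have "measure P (A m) \<le> 2 ^ m * (2 * exp (- (\<epsilon> m)\<^sup>2 / (2 * 2 ^ m)))"
      unfolding A_def by (rule prob_fourier_sup_norm_ge) (simp add: \<epsilon>_def c0)
    \<comment> \<open>The factor \<open>2 ^ m\<close> in the square of the threshold cancels the
      variance, leaving an exponent linear in \<open>m\<close>.\<close>
    also have "- (\<epsilon> m)\<^sup>2 / (2 * 2 ^ m) = real m * (- (c\<^sup>2 / 2))"
      by (simp add: sq)
    also have "2 ^ m * (2 * exp (real m * (- (c\<^sup>2 / 2)))) = 2 * (exp (ln 2) * exp (- (c\<^sup>2 / 2))) ^ m"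
      by (simp only: exp_of_nat_mult power_mult_distrib) simp
    also have "\<dots> = 2 * q ^ m"
      by (simp only: q_def exp_add[symmetric] diff_conv_add_uminus)
    finally show ?thesis .
  qed
  have "AE f in P. \<forall>\<^sub>F m in sequentially. f \<in> space P - A m"
  proof (rule borel_cantelli_AE1)
    show "A m \<in> sets P" for m
      unfolding A_def fourier_sup_norm_event
      using finite_characters fourier_event_measurable by (intro sets.finite_UN) auto
    show "emeasure P (A m) < \<infinity>" for m
      by (simp add: emeasure_eq_measure)
    have "summable (\<lambda>m. 2 * q ^ m)"
      using q by (intro summable_mult summable_geometric) simp
    then show "summable (\<lambda>m. measure P (A m))"
      by (rule summable_comparison_test') (use bound in simp)
  qed
  then show ?thesis
    by (elim AE_mp, intro AE_I2 impI) (auto simp: A_def \<epsilon>_def not_le elim!: eventually_mono)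
qed

theorem mainTheorem3:
  shows "AE f in P.
    limsup (\<lambda>m. ereal (fourier_sup_norm m (restr m f) / (2 powr (real m / 2) * sqrt (real m))))
      \<le> ereal (sqrt (2 * ln 2))"
proof -
  \<comment> \<open>Countably many thresholds decreasing to the limit allow a single null set to
    serve for all of them.\<close>
  define c where "c k = sqrt (2 * ln 2) + inverse (real (Suc k))" for k
  have "AE f in P. \<forall>k. \<forall>\<^sub>F m in sequentially.
      fourier_sup_norm m (restr m f) < c k * (2 powr (real m / 2) * sqrt (real m))"
    unfolding AE_all_countable
    by (intro allI AE_eventually_fourier_sup_norm_less) (simp add: c_def)
  then show ?thesis
  proof (elim AE_mp, intro AE_I2 impI)
    fix f
    let ?r = "\<lambda>m. ereal (fourier_sup_norm m (restr m f) / (2 powr (real m / 2) * sqrt (real m)))"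
    assume ev: "\<forall>k. \<forall>\<^sub>F m in sequentially.
      fourier_sup_norm m (restr m f) < c k * (2 powr (real m / 2) * sqrt (real m))"
    have le: "limsup ?r \<le> ereal (c k)" for k
    proof (rule Limsup_bounded)
      show "\<forall>\<^sub>F m in sequentially. ?r m \<le> ereal (c k)"
        \<comment> \<open>Taking \<open>m > 0\<close> makes the denominator positive; it vanishes at
          \<open>m = 0\<close>.\<close>
        using ev[rule_format, of k] eventually_gt_at_top[of 0]
        by eventually_elim (simp add: pos_divide_le_eq)
    qed
    have "c \<longlonglongrightarrow> sqrt (2 * ln 2)"
      unfolding c_def by (rule LIMSEQ_inverse_real_of_nat_add)
    then have "(\<lambda>k. ereal (c k)) \<longlonglongrightarrow> ereal (sqrt (2 * ln 2))"
      by (rule tendsto_ereal)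
    then show "limsup ?r \<le> ereal (sqrt (2 * ln 2))"
      by (rule LIMSEQ_le_const) (use le in blast)
  qed
qed

end
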